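(* Let $d\ge 2$, let $T$ be the $d$-regular rooted tree, let $\mathcal{C}$ be an extension-closed pseudo-variety of finite groups, and let $G\leq \operatorname{Aut} T$ be weakly regular branch over a subgroup $R$. Suppose that $H\unlhd G$ satisfies $G/H\in\mathcal{C}$ and $R\geq H\geq R'\geq L$, where $L:=\psi^{-1}(H\times\overset{d}{\cdots}\times H)$ and $L\unlhd H$. If $G$ has the $\mathcal{C}$-CSP, then $G$ has the $\mathcal{C}$-CSP modulo $H$ and $H$ has the $\mathcal{C}$-CSP modulo $L$.
   Context: A pseudo-variety of finite groups is a class $\mathcal{C}$ of finite groups closed under taking subgroups, quotients and finite direct products; it is extension-closed if it is also closed under extensions of groups in $\mathcal{C}$ by groups in $\mathcal{C}$. The $d$-regular rooted tree $T$ is the infinite rooted tree in which every vertex has exactly $d$ children; $\operatorname{Aut}T$ is its group of root-preserving automorphisms. For $G\le\operatorname{Aut}T$, $\mathrm{st}_G(n)$ denotes the subgroup of elements of $G$ fixing every vertex at distance $n$ from the root. Identifying each subtree rooted at a first-level vertex with $T$ gives an isomorphism $\psi:\operatorname{Aut}T\to\operatorname{Aut}T\wr\operatorname{Sym}(d)$ under which the stabilizer of the first level in $\operatorname{Aut}T$ maps onto $\operatorname{Aut}T\times\overset{d}{\cdots}\times\operatorname{Aut}T$. A group $G\leq\operatorname{Aut}T$ is weakly regular branch over a non-trivial subgroup $K\le G$ if $\psi(K)\geq K\times\overset{d}{\cdots}\times K$ and $G$ acts transitively on all levels of $T$. $R'$ denotes the derived subgroup of $R$. A group $G\le\operatorname{Aut}T$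 has the $\mathcal{C}$-CSP if every $N\unlhd G$ with $G/N\in\mathcal{C}$ contains $\mathrm{st}_G(n)$ for some $n$. For $M\unlhd G$, $G$ has the $\mathcal{C}$-CSP modulo $M$ if every $N\unlhd G$ with $G/N\in\mathcal{C}$ and $M\leq N$ contains $\mathrm{st}_G(n)$ for some $n$. These notions are applied to $H$ with $\mathrm{st}_H(n)=\mathrm{st}_G(n)\cap H$. *)

theory Defs
  imports "HOL-Algebra.Generated_Groups" "HOL-Library.Cardinality"
begin

text \<open>
  A class of finite groups is given by a set of groups with carriers inside \<^typ>\<open>nat\<close>; since every
  finite group has an isomorphic copy there, no class is lost. A group over an arbitrary
  type belongs to the class if it is isomorphic to a member, so that classes are always read up
  to isomorphism.
\<close>

definition in_class :: "nat monoid set \<Rightarrow> ('g, 'm) monoid_scheme \<Rightarrow> bool" where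
  "in_class \<C> Q \<longleftrightarrow> (\<exists>P\<in>\<C>. Q \<cong> P)"

definition pseudo_variety :: "nat monoid set \<Rightarrow> bool" where
  "pseudo_variety \<C> \<longleftrightarrow>
     (\<forall>P\<in>\<C>. group P \<and> finite (carrier P)) \<and>
     (\<forall>P\<in>\<C>. \<forall>S. subgroup S P \<longrightarrow> in_class \<C> (P\<lparr>carrier := S\<rparr>)) \<and>
     (\<forall>P\<in>\<C>. \<forall>N. N \<lhd> P \<longrightarrow> in_class \<C> (P Mod N)) \<and>
     (\<forall>P\<in>\<C>. \<forall>Q\<in>\<C>. in_class \<C> (P \<times>\<times> Q))"

text \<open>
  An extension of finite groups is finite, hence it suffices to let the extension \<open>E\<close> range over
  groups with carrier inside \<^typ>\<open>nat\<close>.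
\<close>

definition extension_closed :: "nat monoid set \<Rightarrow> bool" where
  "extension_closed \<C> \<longleftrightarrow>
     (\<forall>(E :: nat monoid) N. N \<lhd> E \<longrightarrow> in_class \<C> (E\<lparr>carrier := N\<rparr>) \<longrightarrow> in_class \<C> (E Mod N)
        \<longrightarrow> in_class \<C> E)"

text \<open>
  The vertices of the \<open>d\<close>-regular rooted tree are the words over an alphabet \<open>'x\<close> with
  \<open>d\<close> letters; the root is the empty word, and the children of \<open>v\<close> are the words \<open>v @ [x]\<close>.
  The vertices at distance \<open>n\<close> from the root are the words of length \<open>n\<close>.
\<close>

definition tree_adj :: "'x list \<Rightarrow> 'x list \<Rightarrow> bool" where
  "tree_adj u v \<longleftrightarrow> (\<exists>x. v = u @ [x]) \<or> (\<exists>x. u = v @ [x])"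

definition AutT :: "('x list \<Rightarrow> 'x list) monoid" where
  "AutT = \<lparr>carrier = {g. bij g \<and> g [] = [] \<and> (\<forall>u v. tree_adj (g u) (g v) \<longleftrightarrow> tree_adj u v)},
           mult = (\<circ>), one = id\<rparr>"

definition level_stab :: "('x list \<Rightarrow> 'x list) set \<Rightarrow> nat \<Rightarrow> ('x list \<Rightarrow> 'x list) set" where
  "level_stab G n = {g \<in> G. \<forall>v. length v = n \<longrightarrow> g v = v}"

definition level_transitive :: "('x list \<Rightarrow> 'x list) set \<Rightarrow> bool" where
  "level_transitive G \<longleftrightarrow> (\<forall>u v. length u = length v \<longrightarrow> (\<exists>g\<in>G. g u = v))"

text \<open>
  An automorphism \<open>g\<close> satisfies \<open>g (x # v) = p x # s x v\<close>, where \<open>p\<close> is a permutation of the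
  letters and each \<open>s x\<close> is an automorphism of the tree, obtained by identifying the
  subtrees rooted at \<open>[x]\<close> and \<open>[p x]\<close> with the whole tree. The pair \<open>(s, p)\<close> is the image
  of \<open>g\<close> in the wreath product of \<open>AutT\<close> with the symmetric group on the letters.
\<close>

definition psi :: "('x list \<Rightarrow> 'x list) \<Rightarrow> ('x \<Rightarrow> 'x list \<Rightarrow> 'x list) \<times> ('x \<Rightarrow> 'x)" where
  "psi g = ((\<lambda>x v. tl (g (x # v))), (\<lambda>x. hd (g [x])))"

text \<open>The direct product of \<open>d\<close> copies of \<open>K\<close>, inside the base group of the wreath product.\<close>

definition dpower ::
  "('x list \<Rightarrow> 'x list) set \<Rightarrow> (('x \<Rightarrow> 'x list \<Rightarrow> 'x list) \<times> ('x \<Rightarrow> 'x)) set" where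
  "dpower K = {(s, id) | s. \<forall>x. s x \<in> K}"

definition weakly_regular_branch ::
  "('x list \<Rightarrow> 'x list) set \<Rightarrow> ('x list \<Rightarrow> 'x list) set \<Rightarrow> bool" where
  "weakly_regular_branch G K \<longleftrightarrow>
     subgroup G AutT \<and> subgroup K (AutT\<lparr>carrier := G\<rparr>) \<and> K \<noteq> {\<one>\<^bsub>AutT\<^esub>} \<and>
     dpower K \<subseteq> psi ` K \<and> level_transitive G"

definition CSP :: "nat monoid set \<Rightarrow> ('x list \<Rightarrow> 'x list) set \<Rightarrow> bool" where
  "CSP \<C> G \<longleftrightarrow>
     (\<forall>N. N \<lhd> AutT\<lparr>carrier := G\<rparr> \<longrightarrow> in_class \<C> (AutT\<lparr>carrier := G\<rparr> Mod N)
        \<longrightarrow> (\<exists>n. level_stab G n \<subseteq> N))"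

definition CSP_modulo ::
  "nat monoid set \<Rightarrow> ('x list \<Rightarrow> 'x list) set \<Rightarrow> ('x list \<Rightarrow> 'x list) set \<Rightarrow> bool" where
  "CSP_modulo \<C> G M \<longleftrightarrow>
     (\<forall>N. N \<lhd> AutT\<lparr>carrier := G\<rparr> \<longrightarrow> in_class \<C> (AutT\<lparr>carrier := G\<rparr> Mod N) \<longrightarrow> M \<subseteq> N
        \<longrightarrow> (\<exists>n. level_stab G n \<subseteq> N))"

end

theory Submission
  imports Defs
begin

text \<open>
  Membership of \<open>G/H\<close> in the class already makes the plain congruence subgroup property pass from
  \<open>G\<close> to \<open>H\<close>. If \<open>N \<lhd> H\<close> and \<open>H/N\<close> is in the class, then the \<open>G\<close>-conjugates of \<open>N\<close> are finitely
  many, since \<open>N\<close> is normalised by \<open>H\<close> and \<open>G/H\<close> is finite. Hence \<open>H\<close> modulo their intersection \<open>K\<close>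
  embeds into a finite product of copies of \<open>H/N\<close>, and \<open>G/K\<close> is an extension of \<open>H/K\<close> by \<open>G/H\<close>.
  So \<open>G/K\<close> is in the class, and \<open>K \<le> N\<close> contains a level stabiliser of \<open>G\<close>.
\<close>

section \<open>Closure properties of a class read up to isomorphism\<close>

lemma in_class_iso:
  assumes "in_class \<C> Q" "P \<cong> Q"
  shows "in_class \<C> P"
  using assms iso_trans unfolding in_class_def by blast

lemma in_class_finite:
  assumes "pseudo_variety \<C>" "in_class \<C> Q"
  shows "finite (carrier Q)"
  using assms unfolding in_class_def pseudo_variety_def is_iso_def iso_def
  by (auto simp: bij_betw_finite)

text \<open>By the first isomorphism theorem the quotient is isomorphic to the image of
  \<open>h\<close>, and a class is closed under subgroups. Below, quotients are shown to lie in the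
  class by exhibiting a homomorphism with the right kernel. Closure is stated for the members of
  \<open>\<C>\<close> themselves, so \<open>h\<close> is first followed by an isomorphism
  \<open>i\<close> onto a member \<open>P\<close>.\<close>

lemma (in group_hom) in_class_Mod_kernel:
  assumes pv: "pseudo_variety \<C>" and "in_class \<C> H"
  shows "in_class \<C> (G Mod kernel G H h)"
proof -
  obtain P i where P: "P \<in> \<C>" and i: "i \<in> iso H P"
    using assms(2) unfolding in_class_def is_iso_def by blast
  have "group P"
    using pv P unfolding pseudo_variety_def by blast
  have "i \<circ> h \<in> hom G P"
    using Group.hom_compose[OF homh iso_imp_homomorphism[OF i]] .
  then interpret f: group_hom G P "i \<circ> h"
    using \<open>group P\<close> by (intro group_hom.intro group_hom_axioms.intro G.is_group)
  have "i y = \<one>\<^bsub>P\<^esub> \<longleftrightarrow> y = \<one>\<^bsub>H\<^esub>" if "y \<in> carrier H" for y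
    using inj_on_eq_iff[of i "carrier H" y "\<one>\<^bsub>H\<^esub>"] i that
      Group.hom_one[OF iso_imp_homomorphism[OF i] H.is_group \<open>group P\<close>]
    by (simp add: iso_def bij_betw_def)
  then have ker: "kernel G P (i \<circ> h) = kernel G H h"
    by (auto simp: kernel_def)
  let ?S = "(i \<circ> h) ` carrier G"
  have S: "subgroup ?S P"
    by (rule f.img_is_subgroup)
  \<comment> \<open>The target is cut down to the image because \<open>FactGroup_iso\<close> asks
    for a surjective homomorphism.\<close>
  interpret g: group_hom G "P\<lparr>carrier := ?S\<rparr>" "i \<circ> h"
  proof (intro group_hom.intro group_hom_axioms.intro G.is_group)
    show "group (P\<lparr>carrier := ?S\<rparr>)"
      by (rule subgroup.subgroup_is_group[OF S \<open>group P\<close>])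
    show "i \<circ> h \<in> hom G (P\<lparr>carrier := ?S\<rparr>)"
      using f.homh by (simp add: hom_def)
  qed
  have "G Mod kernel G H h \<cong> P\<lparr>carrier := ?S\<rparr>"
    using g.FactGroup_iso ker by (simp add: kernel_def)
  moreover have "in_class \<C> (P\<lparr>carrier := ?S\<rparr>)"
    using pv P S unfolding pseudo_variety_def by blast
  ultimately show ?thesis
    by (rule in_class_iso[rotated])
qed

lemma in_class_DirProd:
  assumes "pseudo_variety \<C>" "in_class \<C> P" "in_class \<C> Q" "group P"
  shows "in_class \<C> (P \<times>\<times> Q)"
proof -
  obtain P' Q' where PQ: "P' \<in> \<C>" "P \<cong> P'" "Q' \<in> \<C>" "Q \<cong> Q'"
    using assms(2,3) unfolding in_class_def by blast
  then have "in_class \<C> (P' \<times>\<times> Q')"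
    using assms(1) unfolding pseudo_variety_def by blast
  then show ?thesis
    using in_class_iso group.DirProd_iso_trans[OF \<open>group P\<close> PQ(2,4)] by blast
qed

section \<open>Quotients by finite intersections of normal subgroups\<close>

lemma (in normal) group_hom_r_coset: "group_hom G (G Mod H) (\<lambda>a. H #> a)"
  using r_coset_hom_Mod factorgroup_is_group is_group
  by (intro group_hom.intro group_hom_axioms.intro)

lemma (in normal) r_coset_eq_iff:
  assumes "x \<in> carrier G"
  shows "H #> x = H \<longleftrightarrow> x \<in> H"
  using assms coset_join1 coset_join2 subgroup_axioms by blast

text \<open>The diagonal map to \<open>(G Mod M) \<times>\<times> (G Mod N)\<close> has kernel
  \<open>M \<inter> N\<close>, so the quotient by the intersection embeds into a product of two
  groups of the class.\<close>

lemma (in group) in_class_Mod_Int: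
  assumes "pseudo_variety \<C>" and M: "M \<lhd> G" "in_class \<C> (G Mod M)"
    and N: "N \<lhd> G" "in_class \<C> (G Mod N)"
  shows "M \<inter> N \<lhd> G \<and> in_class \<C> (G Mod (M \<inter> N))"
proof -
  interpret M: normal M G by fact
  interpret N: normal N G by fact
  let ?f = "\<lambda>x. (M #> x, N #> x)" and ?P = "(G Mod M) \<times>\<times> (G Mod N)"
  have "group ?P"
    by (simp add: DirProd_group M.factorgroup_is_group N.factorgroup_is_group)
  moreover have "?f \<in> hom G ?P"
    using M.r_coset_hom_Mod N.r_coset_hom_Mod by (auto simp: hom_def)
  ultimately interpret f: group_hom G ?P ?f
    by (intro group_hom.intro group_hom_axioms.intro is_group)
  have "kernel G ?P ?f = M \<inter> N"
    using M.subset M.r_coset_eq_iff N.r_coset_eq_iff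
    unfolding kernel_def one_DirProd one_FactGroup prod.inject by blast
  then show ?thesis
    using f.normal_kernel f.in_class_Mod_kernel assms(1)
      in_class_DirProd[OF assms(1) M(2) N(2) M.factorgroup_is_group] by metis
qed

lemma (in group) in_class_Mod_Inter:
  assumes "pseudo_variety \<C>" "finite \<N>" "\<N> \<noteq> {}"
    and "\<And>N. N \<in> \<N> \<Longrightarrow> N \<lhd> G \<and> in_class \<C> (G Mod N)"
  shows "\<Inter>\<N> \<lhd> G \<and> in_class \<C> (G Mod \<Inter>\<N>)"
  using assms(2-4)
proof (induction \<N> rule: finite_ne_induct)
  case (insert N \<N>)
  then show ?case
    using in_class_Mod_Int[OF assms(1)] by simp
qed simp

section \<open>Extensions over an arbitrary carrier type\<close>

lemma (in group) finite_rcosets_trans: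
  assumes H: "subgroup H G" and K: "subgroup K G" "K \<subseteq> H"
    and fin: "finite (rcosets H)" "finite (rcosets\<^bsub>G\<lparr>carrier := H\<rparr>\<^esub> K)"
  shows "finite (rcosets K)"
proof -
  define r where "r B = (SOME x. x \<in> carrier G \<and> B = H #> x)" for B
  have r: "r B \<in> carrier G \<and> B = H #> r B" if "B \<in> rcosets H" for B
    unfolding r_def by (rule someI_ex) (use that in \<open>auto simp: RCOSETS_def\<close>)
  \<comment> \<open>Write x = h r with h in \<open>H\<close> and r the chosen representative of the
    coset H x. Then K x = (K h) r, so a coset of \<open>K\<close> is determined by a pair from two
    finite sets.\<close>
  have "rcosets K \<subseteq> (\<lambda>(A, B). A #> r B) ` ((rcosets\<^bsub>G\<lparr>carrier := H\<rparr>\<^esub> K) \<times> (rcosets H))"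
  proof
    fix X assume "X \<in> rcosets K"
    then obtain x where x: "x \<in> carrier G" "X = K #> x"
      by (auto simp: RCOSETS_def)
    then have B: "H #> x \<in> rcosets H"
      by (auto simp: RCOSETS_def)
    have "x \<in> H #> r (H #> x)"
      using r[OF B] rcos_self[OF x(1) H] by simp
    then obtain h where h: "h \<in> H" "x = h \<otimes> r (H #> x)"
      by (auto simp: r_coset_def)
    have "h \<in> carrier G"
      using h(1) subgroup.mem_carrier[OF H] by blast
    then have "X = (K #> h) #> r (H #> x)"
      using x(2) h(2) r[OF B] K(1) by (metis coset_mult_assoc subgroup.subset)
    moreover have "K #> h \<in> rcosets\<^bsub>G\<lparr>carrier := H\<rparr>\<^esub> K"
      using h(1) by (auto simp: RCOSETS_def r_coset_def)
    ultimately show "X \<in> (\<lambda>(A, B). A #> r B) ` ((rcosets\<^bsub>G\<lparr>carrier := H\<rparr>\<^esub> K) \<times> (rcosets H))"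
      using B by force
  qed
  then show ?thesis
    using fin finite_subset by fastforce
qed

text \<open>Transport of structure along an injection into the naturals. It brings finite groups to
  the type over which \<open>extension_closed\<close> quantifies.\<close>

lemma (in group) finite_iso_nat_monoid:
  assumes "finite (carrier G)"
  obtains P :: "nat monoid" where "group P" "G \<cong> P"
proof -
  obtain f :: "'a \<Rightarrow> nat" where f: "inj_on f (carrier G)"
    using assms finite_imp_inj_to_nat_seg by metis
  define e where "e = inv_into (carrier G) f"
  define P where "P = \<lparr>carrier = f ` carrier G, mult = \<lambda>a b. f (e a \<otimes> e b), one = f \<one>\<rparr>"
  have "f \<in> iso G P"
    using f by (auto simp: iso_def hom_def P_def e_def bij_betw_def)
  moreover have "monoid P"
    by unfold_locales (use f in \<open>auto simp: P_def e_def m_assoc\<close>)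
  ultimately show ?thesis
    using that iso_imp_group unfolding is_iso_def by blast
qed

text \<open>\<open>G Mod K\<close> is finite, hence has a copy \<open>P\<close> on the naturals.
  There the image of \<open>H\<close> is a normal subgroup isomorphic to H/K, and the quotient by it
  is isomorphic to G/H by the third isomorphism theorem.\<close>

lemma (in group) in_class_extension:
  assumes pv: "pseudo_variety \<C>" and ext: "extension_closed \<C>"
    and H: "H \<lhd> G" "in_class \<C> (G Mod H)"
    and K: "K \<lhd> G" "K \<subseteq> H" "in_class \<C> (G\<lparr>carrier := H\<rparr> Mod K)"
  shows "in_class \<C> (G Mod K)"
proof -
  interpret H: normal H G by fact
  interpret K: normal K G by fact
  have "finite (rcosets H)" "finite (rcosets\<^bsub>G\<lparr>carrier := H\<rparr>\<^esub> K)"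
    using in_class_finite[OF pv H(2)] in_class_finite[OF pv K(3)] by (simp_all add: FactGroup_def)
  then have "finite (carrier (G Mod K))"
    using finite_rcosets_trans K(2) H.subgroup_axioms K.subgroup_axioms
    by (simp add: FactGroup_def)
  then obtain P :: "nat monoid" where P: "group P" "G Mod K \<cong> P"
    using group.finite_iso_nat_monoid[OF K.factorgroup_is_group] by blast
  obtain i where i: "i \<in> iso (G Mod K) P"
    using P(2) unfolding is_iso_def by blast
  \<comment> \<open>The projection to G/K followed by the isomorphism onto \<open>P\<close>: a
    surjection from \<open>G\<close> with kernel \<open>K\<close>. Both isomorphisms needed below
    come from it by the first isomorphism theorem.\<close>
  let ?p = "\<lambda>x. i (K #> x)"
  have surj: "?p ` carrier G = carrier P"
    using i by (auto simp: iso_def bij_betw_def carrier_FactGroup)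
  have "?p \<in> hom G P"
    using Group.hom_compose[OF K.r_coset_hom_Mod iso_imp_homomorphism[OF i]] by (simp add: o_def)
  then interpret p: group_hom G P ?p
    using P(1) by (intro group_hom.intro group_hom_axioms.intro is_group)
  have p_one: "?p x = \<one>\<^bsub>P\<^esub> \<longleftrightarrow> x \<in> K" if "x \<in> carrier G" for x
  proof -
    have "\<one>\<^bsub>P\<^esub> = i K"
      using Group.hom_one[OF iso_imp_homomorphism[OF i] K.factorgroup_is_group P(1)] by simp
    moreover have "K \<in> carrier (G Mod K)" "K #> x \<in> carrier (G Mod K)"
      using K.subgroup_in_rcosets[OF is_group] that by (auto simp: FactGroup_def RCOSETS_def)
    ultimately show ?thesis
      using i K.r_coset_eq_iff[OF that] by (auto simp: iso_def bij_betw_def inj_on_def)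
  qed
  let ?M = "?p ` H"
  have M: "?M \<lhd> P"
    by (rule H.surj_hom_normal_subgroup[OF p.group_hom_axioms surj])
  interpret M: normal ?M P by (rule M)
  have "in_class \<C> (P\<lparr>carrier := ?M\<rparr>)"
  proof -
    interpret q: group_hom "G\<lparr>carrier := H\<rparr>" "P\<lparr>carrier := ?M\<rparr>" ?p
    proof (intro group_hom.intro group_hom_axioms.intro)
      show "group (G\<lparr>carrier := H\<rparr>)"
        by (rule H.subgroup_is_group[OF is_group])
      show "group (P\<lparr>carrier := ?M\<rparr>)"
        by (rule M.subgroup_is_group[OF P(1)])
      show "?p \<in> hom (G\<lparr>carrier := H\<rparr>) (P\<lparr>carrier := ?M\<rparr>)"
        using p.homh H.subset by (auto simp: hom_def subset_iff)
    qed
    have "kernel (G\<lparr>carrier := H\<rparr>) (P\<lparr>carrier := ?M\<rparr>) ?p = K"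
      using p_one K(2) H.subset by (auto simp: kernel_def)
    then have "G\<lparr>carrier := H\<rparr> Mod K \<cong> P\<lparr>carrier := ?M\<rparr>"
      using q.FactGroup_iso by simp
    moreover have "group (G\<lparr>carrier := H\<rparr> Mod K)"
      using normal.factorgroup_is_group q.normal_kernel
        \<open>kernel (G\<lparr>carrier := H\<rparr>) (P\<lparr>carrier := ?M\<rparr>) ?p = K\<close> by metis
    ultimately show ?thesis
      using K(3) in_class_iso group.iso_sym by blast
  qed
  moreover have "in_class \<C> (P Mod ?M)"
  proof -
    let ?q = "\<lambda>x. ?M #>\<^bsub>P\<^esub> ?p x"
    have "?q \<in> hom G (P Mod ?M)"
      using Group.hom_compose[OF p.homh M.r_coset_hom_Mod] by (simp add: o_def)
    then interpret q: group_hom G "P Mod ?M" ?q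
      by (intro group_hom.intro group_hom_axioms.intro is_group M.factorgroup_is_group)
    \<comment> \<open>The preimage of \<open>?M\<close> is no larger than \<open>H\<close>: elements
      with equal images differ by an element of the kernel \<open>K\<close>, which lies in
      \<open>H\<close>.\<close>
    have "x \<in> H" if x: "x \<in> carrier G" "?p x \<in> ?M" for x
    proof -
      obtain h where h: "h \<in> H" "?p x = ?p h"
        using x(2) by blast
      then have "?p (x \<otimes> inv h) = \<one>\<^bsub>P\<^esub>"
        using x(1) h H.mem_carrier[OF h(1)] p.hom_mult[of x "inv h"] p.hom_inv[of h] p.hom_closed[of h]
        by (simp only: inv_closed p.H.r_inv)
      then have "x \<otimes> inv h \<in> H"
        using p_one[of "x \<otimes> inv h"] x(1) H.mem_carrier[OF h(1)] K(2) by auto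
      then show ?thesis
        using x(1) h(1) H.m_closed[of "x \<otimes> inv h" h] by (simp add: H.mem_carrier m_assoc)
    qed
    then have "?q x = ?M \<longleftrightarrow> x \<in> H" if "x \<in> carrier G" for x
      using M.r_coset_eq_iff[OF p.hom_closed[OF that]] that by blast
    then have "kernel G (P Mod ?M) ?q = H"
      using H.subset unfolding kernel_def one_FactGroup by blast
    moreover have "?q ` carrier G = carrier (P Mod ?M)"
      unfolding carrier_FactGroup surj[symmetric] by (simp add: image_image)
    ultimately have "G Mod H \<cong> P Mod ?M"
      using q.FactGroup_iso by simp
    then show ?thesis
      using H(2) in_class_iso group.iso_sym[OF H.factorgroup_is_group] by blast
  qed
  ultimately have "in_class \<C> P"
    using ext M unfolding extension_closed_def by blast
  then show ?thesis
    using P(2) in_class_iso by blast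
qed

section \<open>The normal core of a subgroup of \<open>H\<close>\<close>

lemma (in group) in_class_Mod_normal_core:
  assumes pv: "pseudo_variety \<C>" and ext: "extension_closed \<C>"
    and H: "H \<lhd> G" "in_class \<C> (G Mod H)"
    and N: "N \<lhd> G\<lparr>carrier := H\<rparr>" "in_class \<C> (G\<lparr>carrier := H\<rparr> Mod N)"
  obtains K where "K \<lhd> G" "K \<subseteq> N" "in_class \<C> (G Mod K)"
proof -
  interpret H: normal H G by fact
  interpret N: normal N "G\<lparr>carrier := H\<rparr>" by fact
  have NH: "N \<subseteq> H"
    using N.subset by simp
  \<comment> \<open>For \<open>g\<close> in \<open>G\<close> this is the conjugate of
    \<open>N\<close> by \<open>inv g\<close>, written as a preimage so that it appears as the kernel
    of conjugation by \<open>g\<close> on \<open>H\<close> followed by the projection to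
    H/N.\<close>
  define c where "c g = {x \<in> H. g \<otimes> x \<otimes> inv g \<in> N}" for g
  have c: "c g \<lhd> G\<lparr>carrier := H\<rparr> \<and> in_class \<C> (G\<lparr>carrier := H\<rparr> Mod c g)"
    if g: "g \<in> carrier G" for g
  proof -
    let ?k = "\<lambda>x. g \<otimes> x \<otimes> inv g"
    have k: "?k x \<in> H" if "x \<in> H" for x
      using H.inv_op_closed2[OF g that] .
    have "?k (x \<otimes> y) = ?k x \<otimes> ?k y" if "x \<in> H" "y \<in> H" for x y
      using that g H.mem_carrier by (simp add: m_assoc inv_solve_left)
    then have "?k \<in> hom (G\<lparr>carrier := H\<rparr>) (G\<lparr>carrier := H\<rparr>)"
      using k by (auto simp: hom_def)
    from Group.hom_compose[OF this N.r_coset_hom_Mod]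
    interpret f: group_hom "G\<lparr>carrier := H\<rparr>" "G\<lparr>carrier := H\<rparr> Mod N"
      "(#>\<^bsub>G\<lparr>carrier := H\<rparr>\<^esub>) N \<circ> ?k"
      by (intro group_hom.intro group_hom_axioms.intro N.is_group N.factorgroup_is_group)
    have "kernel (G\<lparr>carrier := H\<rparr>) (G\<lparr>carrier := H\<rparr> Mod N) ((#>\<^bsub>G\<lparr>carrier := H\<rparr>\<^esub>) N \<circ> ?k) = c g"
      using k N.r_coset_eq_iff by (auto simp: kernel_def c_def)
    then show ?thesis
      using f.normal_kernel f.in_class_Mod_kernel[OF pv N(2)] by simp
  qed
  \<comment> \<open>Since \<open>H\<close> normalises \<open>N\<close>, the conjugate depends only
    on the right coset of \<open>H\<close> containing \<open>g\<close>. This is what bounds the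
    number of conjugates.\<close>
  have c_mult: "c (h \<otimes> g) = c g" if h: "h \<in> H" and g: "g \<in> carrier G" for h g
  proof -
    have "(h \<otimes> g) \<otimes> x \<otimes> inv (h \<otimes> g) \<in> N \<longleftrightarrow> g \<otimes> x \<otimes> inv g \<in> N" if x: "x \<in> H" for x
    proof -
      let ?y = "g \<otimes> x \<otimes> inv g"
      have y: "?y \<in> H"
        using H.inv_op_closed2[OF g x] .
      have eq: "(h \<otimes> g) \<otimes> x \<otimes> inv (h \<otimes> g) = h \<otimes> ?y \<otimes> inv h"
        using h g x H.mem_carrier by (simp add: m_assoc inv_mult_group)
      have inv_H: "inv\<^bsub>G\<lparr>carrier := H\<rparr>\<^esub> h = inv h"
        using h H.subgroup_axioms by (simp add: m_inv_consistent)
      have "h \<otimes> ?y \<otimes> inv h \<in> N" if "?y \<in> N"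
        using N.inv_op_closed2[of h ?y] that h inv_H by simp
      moreover have "?y \<in> N" if *: "h \<otimes> ?y \<otimes> inv h \<in> N"
      proof -
        have "inv h \<otimes> (h \<otimes> ?y \<otimes> inv h) \<otimes> h \<in> N"
          using N.inv_op_closed1[of h "h \<otimes> ?y \<otimes> inv h"] * h inv_H by simp
        moreover have "inv h \<otimes> (h \<otimes> ?y \<otimes> inv h) \<otimes> h = ?y"
          using h H.mem_carrier[OF y] H.mem_carrier by (simp add: m_assoc inv_solve_left')
        ultimately show ?thesis by simp
      qed
      ultimately show ?thesis
        using eq by auto
    qed
    then show ?thesis
      by (auto simp: c_def)
  qed
  have "finite (c ` carrier G)"
  proof (rule finite_surj)
    show "finite (rcosets H)"
      using in_class_finite[OF pv H(2)] by (simp add: FactGroup_def)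
    \<comment> \<open>Any element of the coset H g may stand for \<open>g\<close>, by
      \<open>c_mult\<close>.\<close>
    show "c ` carrier G \<subseteq> (\<lambda>X. c (SOME x. x \<in> X)) ` (rcosets H)"
    proof
      fix A assume "A \<in> c ` carrier G"
      then obtain g where g: "g \<in> carrier G" "A = c g" by blast
      have "(SOME x. x \<in> H #> g) \<in> H #> g"
        using rcos_self[OF g(1) H.subgroup_axioms] by (rule someI)
      then have "c (SOME x. x \<in> H #> g) = c g"
        using c_mult g(1) by (auto simp: r_coset_def)
      then show "A \<in> (\<lambda>X. c (SOME x. x \<in> X)) ` (rcosets H)"
        using g by (auto simp: RCOSETS_def)
    qed
  qed
  define K where "K = \<Inter> (c ` carrier G)"
  have K: "K \<lhd> G\<lparr>carrier := H\<rparr> \<and> in_class \<C> (G\<lparr>carrier := H\<rparr> Mod K)"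
    unfolding K_def
    by (rule group.in_class_Mod_Inter[OF N.is_group pv \<open>finite (c ` carrier G)\<close>])
      (use c in auto)
  have KH: "x \<in> K \<Longrightarrow> x \<in> H" for x
    by (auto simp: K_def c_def)
  have "c \<one> = N"
    using NH H.mem_carrier by (auto simp: c_def)
  then have KN: "K \<subseteq> N"
    unfolding K_def by blast
  have "K \<lhd> G"
    unfolding normal_inv_iff
  proof (intro conjI ballI)
    show "subgroup K G"
      using K incl_subgroup[OF H.subgroup_axioms] normal_imp_subgroup by blast
    fix a x assume a: "a \<in> carrier G" and x: "x \<in> K"
    show "a \<otimes> x \<otimes> inv a \<in> K"
      unfolding K_def
    proof (rule InterI)
      fix A assume "A \<in> c ` carrier G"
      then obtain g where g: "g \<in> carrier G" "A = c g" by blast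
      \<comment> \<open>Right multiplication by \<open>a\<close> permutes the indices of the family:
        for x in \<open>H\<close>, the conjugate of x by \<open>a\<close> lies in \<open>c g\<close>
        exactly when x lies in \<open>c (g \<otimes> a)\<close>.\<close>
      have "x \<in> c (g \<otimes> a)"
        using x a g(1) unfolding K_def by blast
      then have "(g \<otimes> a) \<otimes> x \<otimes> inv (g \<otimes> a) \<in> N"
        by (simp add: c_def)
      moreover have "(g \<otimes> a) \<otimes> x \<otimes> inv (g \<otimes> a) = g \<otimes> (a \<otimes> x \<otimes> inv a) \<otimes> inv g"
        using a g(1) H.mem_carrier[OF KH[OF x]] by (simp add: m_assoc inv_mult_group)
      ultimately show "a \<otimes> x \<otimes> inv a \<in> A"
        using g(2) H.inv_op_closed2[OF a KH[OF x]] by (simp add: c_def)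
    qed
  qed
  moreover have "in_class \<C> (G Mod K)"
    using in_class_extension[OF pv ext H \<open>K \<lhd> G\<close>] K KH by blast
  ultimately show ?thesis
    using that KN by blast
qed

section \<open>Passing the congruence subgroup property to \<open>H\<close> and to the relative
  versions\<close>

lemma CSP_normal_subgroup:
  assumes "pseudo_variety \<C>" "extension_closed \<C>"
    and H: "H \<lhd> AutT\<lparr>carrier := G\<rparr>" "in_class \<C> (AutT\<lparr>carrier := G\<rparr> Mod H)"
    and "CSP \<C> G"
  shows "CSP \<C> H"
  unfolding CSP_def
proof (intro allI impI)
  interpret H: normal H "AutT\<lparr>carrier := G\<rparr>" by fact
  fix N assume "N \<lhd> AutT\<lparr>carrier := H\<rparr>" "in_class \<C> (AutT\<lparr>carrier := H\<rparr> Mod N)"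
  then obtain K where "K \<lhd> AutT\<lparr>carrier := G\<rparr>" "K \<subseteq> N" "in_class \<C> (AutT\<lparr>carrier := G\<rparr> Mod K)"
    using H.in_class_Mod_normal_core[OF assms(1,2) H] by auto
  moreover obtain n where "level_stab G n \<subseteq> K"
    using \<open>CSP \<C> G\<close> calculation unfolding CSP_def by blast
  \<comment> \<open>The level \<open>n\<close> found for the core \<open>K\<close> in
    \<open>G\<close> also serves for \<open>N\<close> in \<open>H\<close>, as the stabiliser in
    \<open>H\<close> is the smaller one and \<open>K\<close> lies in \<open>N\<close>.\<close>
  moreover have "level_stab H n \<subseteq> level_stab G n"
    using H.subset by (auto simp: level_stab_def)
  ultimately show "\<exists>n. level_stab H n \<subseteq> N"
    by blast
qed

lemma CSP_imp_CSP_modulo: "CSP \<C> G \<Longrightarrow> CSP_modulo \<C> G M"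
  unfolding CSP_def CSP_modulo_def by blast

theorem corollary8:
  fixes \<C> :: "nat monoid set"
    and G H R L :: "('x::finite list \<Rightarrow> 'x list) set"
  assumes "CARD('x) \<ge> 2"
    and "pseudo_variety \<C>" and "extension_closed \<C>"
    and "subgroup G AutT" and "weakly_regular_branch G R"
    and "H \<lhd> AutT\<lparr>carrier := G\<rparr>" and "in_class \<C> (AutT\<lparr>carrier := G\<rparr> Mod H)"
    and "H \<subseteq> R" and "derived AutT R \<subseteq> H" and "L \<subseteq> derived AutT R"
    and "L = {g \<in> carrier AutT. psi g \<in> dpower H}"
    and "L \<lhd> AutT\<lparr>carrier := H\<rparr>"
    and "CSP \<C> G"
  shows "CSP_modulo \<C> G H \<and> CSP_modulo \<C> H L"
  \<comment> \<open>The first conjunct restricts the property of \<open>G\<close> to normal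
    subgroups containing \<open>H\<close>. The second first transfers the full property to
    \<open>H\<close> and then restricts to those containing \<open>L\<close>.\<close>
  using CSP_imp_CSP_modulo CSP_normal_subgroup assms(2,3,6,7,13) by blast

end
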